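(* There is an absolute constant $c>0$ such that for every prime $p$ and every positive integer $\lambda\le 0.9\sqrt{p}$, the set $A=\{1,2,\dots,\lambda\}\subseteq\mathbb{F}_p^*$ satisfies $$\nu(A)\ge c\,\frac{p}{\lambda\log p}.$$
   Context: $\mathbb{F}_p^*$ is the multiplicative group of the field $\mathbb{F}_p$, whose elements are identified with integers in the usual way. For $A\subseteq\mathbb{F}_p^*$, a set $B\subseteq\mathbb{F}_p^*$ is an $A$-packing set if $|AB|=|A||B|$, where $AB=\{ab:a\in A,b\in B\}$; $\nu(A)$ is the maximal size of an $A$-packing set. $\log$ denotes the natural logarithm. *)

theory Defs
  imports Complex_Main "HOL-Number_Theory.Residues" "HOL-Algebra.Coset"
begin

definition packing_set :: "('a, 'b) monoid_scheme \<Rightarrow> 'a set \<Rightarrow> 'a set \<Rightarrow> bool" where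
  "packing_set G A B \<longleftrightarrow> B \<subseteq> carrier G \<and> card (A <#>\<^bsub>G\<^esub> B) = card A * card B"

(* Only meaningful for a finite carrier: otherwise the set of sizes may be unbounded,
   and card is 0 on infinite sets. *)
definition packing_number :: "('a, 'b) monoid_scheme \<Rightarrow> 'a set \<Rightarrow> nat" where
  "packing_number G A = Max {card B | B. packing_set G A B}"

(* For p prime the carrier is the set {1..p - 1} of integers, with multiplication modulo p. *)
definition mult_group_mod :: "nat \<Rightarrow> int monoid" where
  "mult_group_mod p = units_of (residue_ring (int p))"

lemma carrier_mult_group_mod:
  assumes "prime p"
  shows "carrier (mult_group_mod p) = {1..int p - 1}"
proof -
  interpret residues_prime p "residue_ring (int p)"
    by unfold_locales (use assms in \<open>simp_all add: prime_gt_1_nat\<close>)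
  show ?thesis
    using prime_gt_1_nat[OF assms]
    by (simp add: mult_group_mod_def units_of_def res_prime_units_eq of_nat_diff)
qed

lemma mult_mult_group_mod: "x \<otimes>\<^bsub>mult_group_mod p\<^esub> y = x * y mod int p"
  by (simp add: mult_group_mod_def units_of_def residue_ring_def)

end

theory Submission
  imports Defs "HOL-Number_Theory.Prime_Powers" "HOL-Real_Asymp.Real_Asymp"
begin

text \<open>
  The primes $q$ with $l < q$ and $ql < p$ form a packing set, so it suffices to find many primes
  in $(l, p/l)$. Since $l \le 0.81\,p/l$, this interval may be as short as $(0.81\,x, x)$, which is
  beyond the usual proof of Bertrand's postulate but within reach of Chebyshev's original one:
  comparing the logarithm of $n!\,(n/30)! / ((n/2)!\,(n/3)!\,(n/5)!)$ with $\psi$ gives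
  $An - O(\sqrt n) \le \psi(n) \le \frac{6}{5}An + O(\sqrt n)$, and $0.81 \cdot \frac{6}{5} < 1$.
  Proper prime powers contribute a negligible amount to $\psi$. When $p/l$ is bounded, the
  singleton $\{1\}$ is large enough.
\<close>

section \<open>Chebyshev's psi function and the factorial quotient\<close>

definition chebyshev_psi :: "nat \<Rightarrow> real" where
  "chebyshev_psi n = (\<Sum>d=1..n. mangoldt d)"

text \<open>Chebyshev's constant, about 0.9213: the linear growth rate of
  \<open>fact_quotient_ln\<close>.\<close>

definition chebyshev_const :: real where
  "chebyshev_const = ln 2 / 2 + ln 3 / 3 + ln 5 / 5 - ln 30 / 30"

definition fact_quotient_ln :: "nat \<Rightarrow> real" where
  "fact_quotient_ln n = ln (fact n) - ln (fact (n div 2)) - ln (fact (n div 3))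
     - ln (fact (n div 5)) + ln (fact (n div 30))"

text \<open>From n to n + 1 the quotient \<open>n div d\<close> grows by one exactly for the
  divisors d of n + 1, and over these \<open>mangoldt\<close> sums to ln (n + 1). Terms with d > n
  vanish, so the free bound \<open>K\<close> lets factorials of different arguments be expanded over
  one common range.\<close>

lemma ln_fact_eq_sum_mangoldt:
  assumes "n \<le> K"
  shows "ln (fact n) = (\<Sum>d=1..K. mangoldt d * real (n div d))"
  using assms
proof (induction n)
  case 0
  then show ?case by simp
next
  case (Suc n)
  have div_step: "real (Suc n div d) = real (n div d) + (if d dvd Suc n then 1 else 0)" for d
    by (auto simp: div_Suc mod_eq_0_iff_dvd)
  have divisors: "{d \<in> {1..K}. d dvd Suc n} = {d. d dvd Suc n}"
    using Suc.prems by (auto dest: dvd_imp_le intro!: Suc_leI Nat.gr0I)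
  have "(\<Sum>d=1..K. mangoldt d * real (Suc n div d)) =
      (\<Sum>d=1..K. mangoldt d * real (n div d)) + (\<Sum>d=1..K. if d dvd Suc n then mangoldt d else 0)"
    unfolding div_step sum.distrib[symmetric] by (intro sum.cong) (auto simp: algebra_simps)
  also have "(\<Sum>d=1..K. if d dvd Suc n then mangoldt d else 0) = (\<Sum>d | d dvd Suc n. mangoldt d :: real)"
    by (subst sum.inter_filter[symmetric]) (simp_all only: divisors finite_atLeastAtMost)
  also have "\<dots> = ln (real (Suc n))"
    by (subst mangoldt_sum) auto
  also have "(\<Sum>d=1..K. mangoldt d * real (n div d)) = ln (fact n)"
    using Suc by simp
  finally show ?case
    by (simp add: ln_mult add.commute del: of_nat_Suc)
qed

text \<open>At \<open>n div d\<close> this is the weight of \<open>mangoldt d\<close> in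
  \<open>fact_quotient_ln n\<close>.\<close>

definition chebyshev_coeff :: "nat \<Rightarrow> real" where
  "chebyshev_coeff m = real m - real (m div 2) - real (m div 3) - real (m div 5) + real (m div 30)"

text \<open>Since 30 - 15 - 10 - 6 + 1 = 0, the coefficient is periodic with period 30, and the
  bounds need only be checked on one period.\<close>

lemma chebyshev_coeff_bounds:
  shows "0 \<le> chebyshev_coeff m" "chebyshev_coeff m \<le> 1"
    and "1 \<le> m \<Longrightarrow> m < 6 \<Longrightarrow> chebyshev_coeff m = 1"
proof -
  have periodic: "chebyshev_coeff (30 * q + r) = chebyshev_coeff r" for q r
  proof -
    have "(30 * q + r) div 2 = 15 * q + r div 2" "(30 * q + r) div 3 = 10 * q + r div 3"
      "(30 * q + r) div 5 = 6 * q + r div 5" "(30 * q + r) div 30 = q + r div 30"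
      by linarith+
    then show ?thesis by (simp add: chebyshev_coeff_def)
  qed
  have "\<forall>r\<in>{..<30}. 0 \<le> chebyshev_coeff r \<and> chebyshev_coeff r \<le> 1"
    by (simp add: chebyshev_coeff_def lessThan_nat_numeral lessThan_Suc)
  then have "0 \<le> chebyshev_coeff (m mod 30) \<and> chebyshev_coeff (m mod 30) \<le> 1" by simp
  moreover have "chebyshev_coeff m = chebyshev_coeff (m mod 30)"
    using periodic[of "m div 30" "m mod 30"] by simp
  ultimately show "0 \<le> chebyshev_coeff m" "chebyshev_coeff m \<le> 1" by simp_all
  show "chebyshev_coeff m = 1" if "1 \<le> m" "m < 6"
  proof -
    have "m = 1 \<or> m = 2 \<or> m = 3 \<or> m = 4 \<or> m = 5" using that by auto
    then show ?thesis by (auto simp: chebyshev_coeff_def)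
  qed
qed

lemma fact_quotient_ln_eq_sum:
  "fact_quotient_ln n = (\<Sum>d=1..n. mangoldt d * chebyshev_coeff (n div d))"
proof -
  \<comment> \<open>Both orders of the nested division equal division by the product of k and
    d.\<close>
  have "ln (fact (n div k)) = (\<Sum>d=1..n. mangoldt d * real (n div d div k))" for k
    by (subst ln_fact_eq_sum_mangoldt[of _ n]) (auto simp: div_mult2_eq[symmetric] mult.commute)
  from this[of 2] this[of 3] this[of 5] this[of 30] ln_fact_eq_sum_mangoldt[of n n]
  show ?thesis
    by (simp add: fact_quotient_ln_def chebyshev_coeff_def algebra_simps sum.distrib sum_subtractf)
qed

lemma fact_quotient_ln_le_psi: "fact_quotient_ln n \<le> chebyshev_psi n"
  unfolding fact_quotient_ln_eq_sum chebyshev_psi_def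
  by (intro sum_mono mult_right_le_one_le mangoldt_nonneg chebyshev_coeff_bounds)

text \<open>For n div 6 < d and d at most n, the quotient \<open>n div d\<close> lies in 1..5, where
  the coefficient is exactly 1; the remaining terms of the sum are nonnegative.\<close>

lemma psi_diff_le_fact_quotient_ln:
  "chebyshev_psi n - chebyshev_psi (n div 6) \<le> fact_quotient_ln n"
proof -
  have split: "{1..n} = {1..n div 6} \<union> {n div 6<..n}" by auto
  have "chebyshev_psi n - chebyshev_psi (n div 6) = (\<Sum>d\<in>{n div 6<..n}. mangoldt d)"
    unfolding chebyshev_psi_def split by (subst sum.union_disjoint) auto
  also have "\<dots> = (\<Sum>d\<in>{n div 6<..n}. mangoldt d * chebyshev_coeff (n div d))"
  proof (rule sum.cong)
    fix d assume d: "d \<in> {n div 6<..n}"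
    then have "1 \<le> n div d" by (auto simp: div_greater_zero_iff Suc_le_eq)
    moreover have "n div d < 6"
      using d by (auto simp: div_less_iff_less_mult mult.commute)
    ultimately show "mangoldt d = mangoldt d * chebyshev_coeff (n div d)"
      by (simp add: chebyshev_coeff_bounds(3))
  qed simp
  also have "\<dots> \<le> fact_quotient_ln n"
    unfolding fact_quotient_ln_eq_sum
    by (intro sum_mono2) (auto intro!: mult_nonneg_nonneg mangoldt_nonneg chebyshev_coeff_bounds)
  finally show ?thesis .
qed

section \<open>Stirling-type estimates for the factorial quotient\<close>

lemma ln_fact_bounds:
  assumes "n \<ge> 1"
  shows "real n * ln n - n \<le> ln (fact n)" "ln (fact n) \<le> real n * ln n - n + ln n + 1"
proof -
  have "real n * ln n - n \<le> ln (fact n) \<and> ln (fact n) \<le> real n * ln n - n + ln n + 1"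
    using assms
  proof (induction n rule: nat_induct_at_least)
    case base
    then show ?case by simp
  next
    case (Suc n)
    have fact_Suc_ln: "ln (fact (Suc n)) = ln (real (Suc n)) + ln (fact n)"
      by (simp add: ln_mult del: of_nat_Suc)
    \<comment> \<open>Applying ln x \<le> x - 1 to (n+1)/n and to its inverse encloses ln (n+1) - ln
      n between 1/(n+1) and 1/n. The upper estimate carries the lower bound through the induction,
      the lower estimate the upper bound.\<close>
    have "ln (real (Suc n) / real n) \<le> real (Suc n) / real n - 1"
      using Suc by (intro ln_le_minus_one) auto
    then have 1: "real n * (ln (real (Suc n)) - ln (real n)) \<le> 1"
      using Suc by (simp add: ln_div field_simps)
    have "ln (real n / real (Suc n)) \<le> real n / real (Suc n) - 1"
      using Suc by (intro ln_le_minus_one) auto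
    then have 2: "(real n + 1) * (ln (real (Suc n)) - ln (real n)) \<ge> 1"
      using Suc by (simp add: ln_div field_simps)
    from 1 2 Suc.IH show ?case
      unfolding fact_Suc_ln by (simp add: algebra_simps)
  qed
  then show "real n * ln n - n \<le> ln (fact n)" "ln (fact n) \<le> real n * ln n - n + ln n + 1"
    by auto
qed

text \<open>The function t ln t - t has derivative ln t, so it grows by between 0 and ln x from m =
  floor x \<ge> 1 up to x. Rounding thus costs no more than the logarithmic error already present in
  \<open>ln_fact_bounds\<close>.\<close>

lemma ln_fact_div_approx:
  assumes "n \<ge> 1" "k \<ge> 1"
  shows "\<bar>ln (fact (n div k)) - (real n / k * ln (real n / k) - real n / k)\<bar> \<le> ln (real n) + 1"
proof -
  define x where "x = real n / real k"
  define m where "m = n div k"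
  have x: "0 < x" using assms by (simp add: x_def)
  have "x \<le> real n / 1" unfolding x_def using assms by (intro divide_left_mono) auto
  then have lnx: "ln x \<le> ln (real n)" and lnn: "0 \<le> ln (real n)" using x assms by auto
  have mf: "int m = \<lfloor>x\<rfloor>" by (simp add: m_def x_def floor_divide_of_nat_eq)
  then have mx: "real m \<le> x" "x < real m + 1" by linarith+
  show ?thesis
  proof (cases "m = 0")
    case True
    \<comment> \<open>Here x < 1 and the factorial is 1. As x ln x - x lies between -1 and 0, the
      error is at most 1.\<close>
    have "ln x \<le> 0" using x mx True by simp
    then have "x * ln x \<le> 0" using x by (simp add: mult_nonneg_nonpos)
    moreover have "ln (1/x) \<le> 1/x - 1" using x by (intro ln_le_minus_one) auto
    then have "x * ln x \<ge> x - 1" using x by (simp add: ln_div field_simps)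
    ultimately show ?thesis
      using True x mx lnn unfolding m_def[symmetric] x_def[symmetric] by simp
  next
    case False
    then have m: "m \<ge> 1" by simp
    note b = ln_fact_bounds[OF m]
    have "ln (x / real m) \<le> x / real m - 1" using x m by (intro ln_le_minus_one) auto
    then have 1: "real m * (ln x - ln (real m)) \<le> x - real m"
      using x m by (simp add: ln_div field_simps)
    have lm: "0 \<le> ln (real m)" "ln (real m) \<le> ln x" using m mx by auto
    have 2: "(x - m) * ln x \<le> 1 * ln x" using mx lm by (intro mult_right_mono) auto
    have low: "x * ln x - x - ln x \<le> real m * ln m - m"
      using 1 2 by (simp add: algebra_simps)
    have "ln (real m / x) \<le> real m / x - 1" using x m by (intro ln_le_minus_one) auto
    then have 3: "x * (ln x - ln (real m)) \<ge> x - real m"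
      using x m by (simp add: ln_div field_simps)
    have 4: "(x - m) * ln m \<ge> 0" using mx lm by (intro mult_nonneg_nonneg) auto
    have up: "real m * ln m - m \<le> x * ln x - x"
      using 3 4 by (simp add: algebra_simps)
    show ?thesis using b low up lm lnx
      unfolding m_def[symmetric] x_def[symmetric] by (simp add: abs_le_iff)
  qed
qed

lemma ln_plus_one_le_sqrt:
  assumes "n \<ge> 1"
  shows "ln (real n) + 1 \<le> 2 * sqrt (real n)"
proof -
  have "ln (sqrt (real n)) \<le> sqrt (real n) - 1" using assms by (intro ln_le_minus_one) auto
  then show ?thesis using assms by (simp add: ln_sqrt)
qed

lemma fact_quotient_ln_approx:
  assumes "n \<ge> 1"
  shows "\<bar>fact_quotient_ln n - chebyshev_const * n\<bar> \<le> 10 * sqrt (real n)"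
proof -
  define g where "g k = real n / real k * ln (real n / real k) - real n / real k" for k :: nat
  have g: "\<bar>ln (fact (n div k)) - g k\<bar> \<le> 2 * sqrt (real n)" if "k \<ge> 1" for k
    using ln_fact_div_approx[OF assms that] ln_plus_one_le_sqrt[OF assms] unfolding g_def by linarith
  \<comment> \<open>Because 1 - 1/2 - 1/3 - 1/5 + 1/30 = 0, the terms in n ln n and in n cancel,
    leaving only those in ln k / k. Five errors of 2 sqrt n make up the 10.\<close>
  have "g 1 - g 2 - g 3 - g 5 + g 30 = chebyshev_const * n"
    using assms by (simp add: g_def chebyshev_const_def ln_div field_simps)
  then show ?thesis
    using g[of 1] g[of 2] g[of 3] g[of 5] g[of 30]
    unfolding fact_quotient_ln_def by (simp add: abs_le_iff)
qed

section \<open>Chebyshev's bounds for psi\<close>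

lemma chebyshev_const_pos: "chebyshev_const > 0"
proof -
  have "ln (30::real) = ln 2 + ln 3 + ln 5"
    using ln_mult[of "2::real" 15] ln_mult[of "3::real" 5] by simp
  then have "chebyshev_const = ln 2 * (7/15) + ln 3 * (3/10) + ln 5 * (1/6)"
    by (simp add: chebyshev_const_def field_simps)
  moreover have "ln 2 > (0::real)" "ln 3 > (0::real)" "ln 5 > (0::real)" by auto
  ultimately show ?thesis by linarith
qed

lemma chebyshev_psi_ge:
  assumes "n \<ge> 1"
  shows "chebyshev_psi n \<ge> chebyshev_const * n - 10 * sqrt (real n)"
  using fact_quotient_ln_approx[OF assms] fact_quotient_ln_le_psi[of n] by linarith

text \<open>Strong induction, descending from n to \<open>n div 6\<close>. The factor 6/5 is the sum
  of the geometric series 1 + 1/6 + 1/36 + ..., hence the solution of c = 1 + c/6.\<close>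

lemma chebyshev_psi_le:
  "chebyshev_psi n \<le> 6 / 5 * chebyshev_const * n + 20 * sqrt (real n)"
proof (induction n rule: less_induct)
  case (less n)
  show ?case
  proof (cases "n = 0")
    case True
    then show ?thesis by (simp add: chebyshev_psi_def)
  next
    case False
    have "chebyshev_psi n \<le> chebyshev_psi (n div 6) + chebyshev_const * n + 10 * sqrt (real n)"
      using fact_quotient_ln_approx[of n] psi_diff_le_fact_quotient_ln[of n] False by linarith
    also have "chebyshev_psi (n div 6) \<le>
        6 / 5 * chebyshev_const * real (n div 6) + 20 * sqrt (real (n div 6))"
      using less False by simp
    also have "6 / 5 * chebyshev_const * real (n div 6) \<le> 6 / 5 * chebyshev_const * (real n / 6)"
      using chebyshev_const_pos by (intro mult_left_mono) auto
    \<comment> \<open>Weakening n/6 to n/4 halves the square root exactly, so the error reproduces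
      itself: 20/2 + 10 = 20.\<close>
    also have "sqrt (real (n div 6)) \<le> sqrt (real n / 4)"
      by (intro real_sqrt_le_mono) linarith
    also have "sqrt (real n / 4) = sqrt (real n) / 2"
      by (simp add: real_sqrt_divide)
    finally show ?thesis by (simp add: algebra_simps)
  qed
qed

section \<open>From psi to primes in short intervals\<close>

lemma card_proper_prime_powers_le:
  assumes "n \<ge> 1"
  shows "real (card {d \<in> {1..n}. primepow d \<and> \<not> prime d}) \<le> sqrt (real n) * log 2 (real n)"
proof -
  define s where "s = nat \<lfloor>sqrt (real n)\<rfloor>"
  define t where "t = nat \<lfloor>log 2 (real n)\<rfloor>"
  \<comment> \<open>A proper prime power has exponent k \<ge> 2, which forces its base below sqrt n;
    as the base is at least 2, also k \<le> log 2 n.\<close>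
  have "{d \<in> {1..n}. primepow d \<and> \<not> prime d} \<subseteq> (\<lambda>(q, k). q ^ k) ` ({1..s} \<times> {1..t})"
  proof
    fix d assume "d \<in> {d \<in> {1..n}. primepow d \<and> \<not> prime d}"
    then obtain q k where qk: "prime q" "k > 0" "d = q ^ k" "\<not> prime d" "d \<le> n"
      by (auto simp: primepow_def)
    have q: "q \<ge> 2" using qk(1) by (rule prime_ge_2_nat)
    have "k \<noteq> 1" using qk by auto
    then have "k \<ge> 2" using qk by simp
    then have "q ^ 2 \<le> q ^ k" using q by (intro power_increasing) auto
    then have "q ^ 2 \<le> n" using qk by simp
    then have "real q ^ 2 \<le> real n" by (metis of_nat_le_iff of_nat_power)
    then have "real q \<le> sqrt (real n)" by (intro real_le_rsqrt)
    then have "q \<le> s" unfolding s_def by (simp add: le_nat_floor)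
    have "2 ^ k \<le> q ^ k" using q by (intro power_mono) auto
    then have "2 ^ k \<le> n" using qk by linarith
    then have "real (2 ^ k) \<le> real n" by (rule of_nat_mono)
    then have "real k \<le> log 2 (real n)" using assms by (simp add: le_log_iff powr_realpow)
    then have "k \<le> t" unfolding t_def by (simp add: le_nat_floor)
    with \<open>q \<le> s\<close> qk q have "(q, k) \<in> {1..s} \<times> {1..t}" by simp
    with qk(3) show "d \<in> (\<lambda>(q, k). q ^ k) ` ({1..s} \<times> {1..t})"
      by (intro image_eqI[of _ _ "(q, k)"]) simp_all
  qed
  then have "card {d \<in> {1..n}. primepow d \<and> \<not> prime d} \<le> card ({1..s} \<times> {1..t})"
    by (rule surj_card_le[rotated]) simp
  then have "real (card {d \<in> {1..n}. primepow d \<and> \<not> prime d}) \<le> real s * real t"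
    by (simp flip: of_nat_mult)
  also have "\<dots> \<le> sqrt (real n) * log 2 (real n)"
    using assms unfolding s_def t_def by (intro mult_mono) auto
  finally show ?thesis .
qed

lemma psi_diff_le_prime_count:
  assumes "n \<ge> 1" "m \<le> n"
  shows "chebyshev_psi n - chebyshev_psi m \<le>
    ln (real n) * (real (card {q \<in> {m<..n}. prime q}) + sqrt (real n) * log 2 (real n))"
proof -
  have split: "{1..n} = {1..m} \<union> {m<..n}" using assms by auto
  define P where "P = {d \<in> {m<..n}. primepow d}"
  have "chebyshev_psi n - chebyshev_psi m = (\<Sum>d\<in>{m<..n}. mangoldt d)"
    unfolding chebyshev_psi_def split by (subst sum.union_disjoint) auto
  also have "\<dots> = (\<Sum>d\<in>P. mangoldt d)"
    unfolding P_def by (intro sum.mono_neutral_right) (auto simp: mangoldt_def)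
  also have "\<dots> \<le> (\<Sum>d\<in>P. ln (real n))"
  proof (rule sum_mono)
    fix d assume "d \<in> P"
    then have d: "d > 0" "d \<le> n" by (auto simp: P_def)
    then have "mangoldt d \<le> ln (real d)" by (intro mangoldt_le)
    also have "\<dots> \<le> ln (real n)" using d by simp
    finally show "mangoldt d \<le> ln (real n)" .
  qed
  also have "\<dots> = ln (real n) * real (card P)" by simp
  also have "\<dots> \<le> ln (real n) * (real (card {q \<in> {m<..n}. prime q}) + sqrt (real n) * log 2 (real n))"
  proof (intro mult_left_mono)
    have "card P \<le> card ({q \<in> {m<..n}. prime q} \<union> {d \<in> {1..n}. primepow d \<and> \<not> prime d})"
      unfolding P_def by (intro card_mono) auto
    also have "\<dots> \<le> card {q \<in> {m<..n}. prime q} + card {d \<in> {1..n}. primepow d \<and> \<not> prime d}"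
      by (rule card_Un_le)
    finally show "real (card P) \<le> real (card {q \<in> {m<..n}. prime q}) + sqrt (real n) * log 2 (real n)"
      using card_proper_prime_powers_le[OF assms(1)] by linarith
  qed (use assms in auto)
  finally show ?thesis .
qed

text \<open>The bound on m involves n + 1 because n will be an integer part of (p - 1) / l, for
  which only p / l \<le> n + 1 is available.\<close>

lemma prime_count_short_interval:
  "\<exists>c>0. \<exists>n0\<ge>2. \<forall>n\<ge>n0. \<forall>m. real m \<le> 81 / 100 * (real n + 1) \<longrightarrow>
     real (card {q \<in> {m<..n}. prime q}) \<ge> c * real n / ln (real n)"
proof -
  define A where "A = chebyshev_const"
  have A: "A > 0" unfolding A_def by (rule chebyshev_const_pos)
  \<comment> \<open>The errors of both psi bounds and the proper prime powers together are of order
    sqrt n (ln n)^2, hence o(n).\<close>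
  have "((\<lambda>n. (10 * sqrt (real n) + 20 * sqrt (real n + 1)
      + ln (real n) * (sqrt (real n) * log 2 (real n))) / real n) \<longlongrightarrow> 0) at_top"
    unfolding log_def by real_asymp
  then have "\<forall>\<^sub>F n in at_top. (10 * sqrt (real n) + 20 * sqrt (real n + 1)
      + ln (real n) * (sqrt (real n) * log 2 (real n))) / real n < A / 1000"
    using A by (intro order_tendstoD(2)) auto
  then obtain n1 where n1: "\<And>n. n \<ge> n1 \<Longrightarrow> (10 * sqrt (real n) + 20 * sqrt (real n + 1)
      + ln (real n) * (sqrt (real n) * log 2 (real n))) / real n < A / 1000"
    by (auto simp: eventually_at_top_linorder)
  have "A / 100 * real n / ln (real n) \<le> real (card {q \<in> {m<..n}. prime q})"
    if n: "n \<ge> max n1 1000" and m: "real m \<le> 81 / 100 * (real n + 1)" for n m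
  proof -
    have n': "n \<ge> 1000" "n \<ge> n1" using n by auto
    have "real n \<ge> 1000" using n' by simp
    moreover have "100 * real m \<le> 81 * real n + 81" using m by simp
    ultimately have "real m \<le> real n" by linarith
    then have mn: "m \<le> n" by simp
    have "6 / 5 * A * real m \<le> 6 / 5 * A * (81 / 100 * (real n + 1))"
      using A m by (intro mult_left_mono) auto
    moreover have "sqrt (real m) \<le> sqrt (real n + 1)"
      using mn by (intro real_sqrt_le_mono) auto
    ultimately have 1: "chebyshev_psi m \<le> 6 / 5 * A * (81 / 100 * (real n + 1)) + 20 * sqrt (real n + 1)"
      using chebyshev_psi_le[of m] unfolding A_def by linarith
    have 2: "chebyshev_psi n \<ge> A * real n - 10 * sqrt (real n)"
      using chebyshev_psi_ge[of n] n' unfolding A_def by simp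
    have 3: "10 * sqrt (real n) + 20 * sqrt (real n + 1)
      + ln (real n) * (sqrt (real n) * log 2 (real n)) \<le> A / 1000 * real n"
      using n1[OF n'(2)] n' by (simp add: field_simps)
    have 4: "A * 1000 \<le> A * real n" using n' A by simp
    have "A / 100 * real n \<le> ln (real n) * real (card {q \<in> {m<..n}. prime q})"
    proof -
      define E where "E = ln (real n) * (sqrt (real n) * log 2 (real n))"
      define Q where "Q = ln (real n) * real (card {q \<in> {m<..n}. prime q})"
      have "chebyshev_psi n - chebyshev_psi m \<le> Q + E"
        using psi_diff_le_prime_count[of n m] n' mn unfolding Q_def E_def by (simp add: distrib_left)
      moreover have "1000 * chebyshev_psi m \<le> 972 * (A * real n) + 972 * A + 20000 * sqrt (real n + 1)"
        using 1 by (simp add: field_simps)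
      moreover have "10000 * sqrt (real n) + 20000 * sqrt (real n + 1) + 1000 * E \<le> A * real n"
        using 3 unfolding E_def[symmetric] by (simp add: field_simps)
      \<comment> \<open>In units of A n: the main terms leave 1 - 0.972 = 0.028, the shift in n + 1
        costs at most 0.000972 since n \<ge> 1000, and the errors cost 0.001. More than the required
        0.01 remains.\<close>
      ultimately have "A * real n \<le> 100 * Q" using 2 4 A by linarith
      then show ?thesis unfolding Q_def by simp
    qed
    then show ?thesis using n' by (simp add: field_simps)
  qed
  moreover have "A / 100 > 0" "max n1 1000 \<ge> 2" using A by auto
  ultimately show ?thesis by blast
qed

section \<open>Packing sets in the multiplicative group\<close>

lemma set_mult_mult_group_mod:
  "A <#>\<^bsub>mult_group_mod p\<^esub> B = (\<lambda>(a, b). a * b mod int p) ` (A \<times> B)"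
  by (auto simp: set_mult_def mult_mult_group_mod)

text \<open>The carrier is finite, so the \<open>Max\<close> ranges over a finite set of sizes and
  is a genuine upper bound.\<close>

lemma card_le_packing_number:
  assumes "prime p" "packing_set (mult_group_mod p) A B"
  shows "card B \<le> packing_number (mult_group_mod p) A"
proof -
  have "{card B | B. packing_set (mult_group_mod p) A B} \<subseteq> card ` Pow {1..int p - 1}"
    using carrier_mult_group_mod[OF assms(1)] by (auto simp: packing_set_def)
  then have "finite {card B | B. packing_set (mult_group_mod p) A B}"
    by (rule finite_subset) simp
  then show ?thesis unfolding packing_number_def using assms(2) by (intro Max_ge) auto
qed

lemma one_le_packing_number:
  assumes "prime p" "l < p"
  shows "1 \<le> packing_number (mult_group_mod p) {1..int l}"
proof -
  have "{1..int l} \<times> {1} = (\<lambda>a. (a, 1::int)) ` {1..int l}" by auto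
  then have "{1..int l} <#>\<^bsub>mult_group_mod p\<^esub> {1} = (\<lambda>a. a mod int p) ` {1..int l}"
    by (simp add: set_mult_mult_group_mod image_image)
  also have "\<dots> = (\<lambda>a. a) ` {1..int l}"
    using assms(2) by (intro image_cong) auto
  finally have "{1..int l} <#>\<^bsub>mult_group_mod p\<^esub> {1} = {1..int l}" by simp
  then have "packing_set (mult_group_mod p) {1..int l} {1}"
    using prime_gt_1_nat[OF assms(1)] by (simp add: packing_set_def carrier_mult_group_mod[OF assms(1)])
  from card_le_packing_number[OF assms(1) this] show ?thesis by simp
qed

text \<open>As $aq < p$ for all $a \le l$ and $q \le n$, a collision $aq \equiv a'q'$ modulo $p$ is an
  equality of integers; if $q \ne q'$ it forces $q \mid a'$, against $a' \le l < q$.\<close>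
lemma packing_set_primes:
  assumes p: "prime p" and n: "n * l < p" and l: "l > 0"
  shows "packing_set (mult_group_mod p) {1..int l} (int ` {q \<in> {l<..n}. prime q})"
proof -
  let ?B = "{q \<in> {l<..n}. prime q}"
  have lt: "a * b < p" if "a \<le> l" "b \<in> ?B" for a b
  proof -
    have "a * b \<le> l * n" using that by (intro mult_mono) auto
    then show ?thesis using n by (simp add: mult.commute)
  qed
  \<comment> \<open>The instance a = 1 of \<open>lt\<close> puts every chosen prime below p.\<close>
  have B: "int ` ?B \<subseteq> carrier (mult_group_mod p)"
    using lt[of 1] l by (auto simp: carrier_mult_group_mod[OF p] Suc_le_eq prime_gt_0_nat)
  have A: "{1..int l} = int ` {1..l}" by (simp add: image_int_atLeastAtMost)
  have prod: "int ` {1..l} \<times> int ` ?B = (\<lambda>(a, b). (int a, int b)) ` ({1..l} \<times> ?B)"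
    by auto
  have no_wrap: "int a * int b mod int p = int a * int b" if "a \<le> l" "l < b" "b \<le> n" "prime b" for a b
    using lt[of a b] that by (simp flip: of_nat_mult)
  have "{1..int l} <#>\<^bsub>mult_group_mod p\<^esub> (int ` ?B) = (\<lambda>(a, b). int (a * b)) ` ({1..l} \<times> ?B)"
    unfolding set_mult_mult_group_mod A prod image_image
    by (intro image_cong) (auto simp: no_wrap)
  moreover have "inj_on (\<lambda>(a, b). int (a * b)) ({1..l} \<times> ?B)"
  proof (rule inj_onI, clarify)
    fix a b a' b'
    assume *: "a \<in> {1..l}" "a' \<in> {1..l}" "b \<in> {l<..n}" "prime b" "b' \<in> {l<..n}" "prime b'"
      and "int (a * b) = int (a' * b')"
    then have eq: "a * b = a' * b'" by (simp only: of_nat_eq_iff)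
    have "\<not> b dvd a'" using * by (auto dest: dvd_imp_le)
    moreover have "b dvd a' * b'" using eq by (metis dvd_triv_right)
    ultimately have "b dvd b'" using * by (simp add: prime_dvd_mult_iff)
    then have "b = b'" using * by (simp add: primes_dvd_imp_eq)
    with eq * show "a = a' \<and> b = b'" by auto
  qed
  ultimately have "card ({1..int l} <#>\<^bsub>mult_group_mod p\<^esub> (int ` ?B)) = card {1..int l} * card (int ` ?B)"
    by (simp add: card_image card_cartesian_product)
  with B show ?thesis by (simp add: packing_set_def)
qed

section \<open>Choice of the interval and of the constant\<close>

theorem mainTheorem3:
  shows "\<exists>c::real. c > 0 \<and>
    (\<forall>(p::nat) (l::nat). prime p \<longrightarrow> 0 < l \<longrightarrow> real l \<le> 0.9 * sqrt (real p) \<longrightarrow>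
      real (packing_number (mult_group_mod p) {1..int l}) \<ge> c * (real p / (real l * ln (real p))))"
proof -
  obtain c n0 where c: "c > 0" and n0: "n0 \<ge> 2"
    and count: "\<And>n m. n \<ge> n0 \<Longrightarrow> real m \<le> 81 / 100 * (real n + 1) \<Longrightarrow>
      c * real n / ln (real n) \<le> real (card {q \<in> {m<..n}. prime q})"
    using prime_count_short_interval by metis
  \<comment> \<open>The first entry pays for n + 1 \<le> 2n when n \<ge> n0; the second makes the
    claimed bound at most 1 when n < n0, where a singleton suffices.\<close>
  define c' where "c' = min (c / 2) (ln 2 / (real n0 + 1))"
  have c': "c' > 0" using c by (simp add: c'_def)
  have c'_le: "c' \<le> c / 2" "c' \<le> ln 2 / (real n0 + 1)"
    unfolding c'_def by (rule min.cobounded1, rule min.cobounded2)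
  have "c' * (real p / (real l * ln (real p))) \<le> real (packing_number (mult_group_mod p) {1..int l})"
    if p: "prime p" and l: "0 < l" and le: "real l \<le> 0.9 * sqrt (real p)" for p l :: nat
  proof -
    have p2: "p \<ge> 2" using p by (rule prime_ge_2_nat)
    \<comment> \<open>The largest n with n l < p. Taking p - 1 keeps the inequality strict even for
      l = 1.\<close>
    define n where "n = (p - 1) div l"
    have nl: "n * l < p"
      using p2 div_times_less_eq_dividend[of "p - 1" l] unfolding n_def by linarith
    have "p - 1 < (n + 1) * l"
      unfolding n_def using l by (simp add: dividend_less_div_times)
    then have "p \<le> (n + 1) * l" by linarith
    then have "real p \<le> real ((n + 1) * l)" by (rule of_nat_mono)
    then have pn: "real p \<le> (real n + 1) * real l" by (simp add: algebra_simps)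
    \<comment> \<open>Squaring 0.9 gives the 81/100 of the prime count: l \<le> 0.81 p / l \<le>
      0.81 (n + 1).\<close>
    have "real l * real l \<le> (9 / 10 * sqrt (real p)) * (9 / 10 * sqrt (real p))"
      using le by (intro mult_mono) auto
    then have ll: "real l * real l \<le> 81 / 100 * real p" by simp
    also have "\<dots> \<le> 81 / 100 * (real n + 1) * real l" using pn by linarith
    finally have ln1: "real l \<le> 81 / 100 * (real n + 1)" using l by simp
    have "real l * 1 \<le> real l * real l" using l by (intro mult_left_mono) auto
    then have lp: "l < p" using ll p2 by linarith
    have lnp: "ln 2 \<le> ln (real p)" "0 \<le> ln (real p)" using p2 by auto
    have ln2: "ln (2::real) > 0" by simp
    have "c' * (real p / (real l * ln (real p))) \<le> c' * ((real n + 1) / ln (real p))"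
      using c' l lnp ln2 pn p2 by (intro mult_left_mono) (simp_all add: field_simps)
    also have "\<dots> \<le> real (packing_number (mult_group_mod p) {1..int l})"
    proof (cases "n \<ge> n0")
      case True
      have "n * 1 \<le> n * l" using l by (intro mult_left_mono) auto
      then have "n \<le> p" using nl by linarith
      then have lnn: "ln (real n) \<le> ln (real p)" "0 < ln (real n)" "0 \<le> ln (real p)"
        using True n0 by auto
      \<comment> \<open>Besides n + 1 \<le> 2n, this uses n \<le> p to pass from ln p to the smaller
        ln n.\<close>
      have "c' * ((real n + 1) / ln (real p)) \<le> (c / 2) * ((2 * real n) / ln (real n))"
        using c'_le c True n0 lnn by (intro mult_mono frac_le divide_nonneg_nonneg) auto
      also have "\<dots> = c * real n / ln (real n)" by simp
      also have "\<dots> \<le> real (card {q \<in> {l<..n}. prime q})" using count[OF True ln1] .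
      also have "\<dots> \<le> real (packing_number (mult_group_mod p) {1..int l})"
        using card_le_packing_number[OF p packing_set_primes[OF p nl l]] by (simp add: card_image)
      finally show ?thesis .
    next
      case False
      have "c' * ((real n + 1) / ln (real p)) \<le> ln 2 / (real n0 + 1) * ((real n0 + 1) / ln 2)"
        using c'_le(2) False lnp ln2 by (intro mult_mono frac_le divide_nonneg_nonneg; linarith)
      also have "\<dots> = 1" using ln2 by simp
      also have "\<dots> \<le> real (packing_number (mult_group_mod p) {1..int l})"
        using one_le_packing_number[OF p lp] by simp
      finally show ?thesis .
    qed
    finally show ?thesis .
  qed
  with c' show ?thesis by blast
qed

end
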